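(* Let $X$ be a continuum and $p\in X$. Then $p$ is a shore point of $X$ if and only if $p$ is a proper shore point of $X$.
   Context: A continuum is a nondegenerate (more than one point) compact connected Hausdorff space, not necessarily metrizable. A subcontinuum of $X$ is a nonempty compact connected subset (singletons allowed). The composant $\kappa(p)$ of $p\in X$ is the union of all proper subcontinua of $X$ that contain $p$. A point $p\in X$ is a shore point if for every finite collection of nonempty open sets $U_1,\dots,U_N\subset X$ some subcontinuum $K\subset X\setminus\{p\}$ meets each $U_n$. A point $p\in X$ is a proper shore point if for every finite collection of nonempty open sets $U_1,\dots,U_N\subset X$ some subcontinuum $K\subset \kappa(p)\setminus\{p\}$ meets each $U_n$. *)

theory Defs
  imports "HOL-Analysis.Analysis"
begin

definition continuum :: "'a topology \<Rightarrow> bool" where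
  "continuum X \<longleftrightarrow> compact_space X \<and> connected_space X \<and> Hausdorff_space X \<and>
     (\<exists>x \<in> topspace X. \<exists>y \<in> topspace X. x \<noteq> y)"

text \<open>Unlike a continuum, a subcontinuum may be a singleton. The predicates \<^const>\<open>compactin\<close>
  and \<^const>\<open>connectedin\<close> include containment in the underlying space.\<close>

definition subcontinuum :: "'a topology \<Rightarrow> 'a set \<Rightarrow> bool" where
  "subcontinuum X K \<longleftrightarrow> K \<noteq> {} \<and> compactin X K \<and> connectedin X K"

definition composant :: "'a topology \<Rightarrow> 'a \<Rightarrow> 'a set" where
  "composant X p = \<Union>{K. subcontinuum X K \<and> K \<noteq> topspace X \<and> p \<in> K}"

definition shore_point :: "'a topology \<Rightarrow> 'a \<Rightarrow> bool" where
  "shore_point X p \<longleftrightarrow> p \<in> topspace X \<and>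
     (\<forall>\<U>. finite \<U> \<and> (\<forall>U\<in>\<U>. openin X U \<and> U \<noteq> {}) \<longrightarrow>
        (\<exists>K. subcontinuum X K \<and> K \<subseteq> topspace X - {p} \<and> (\<forall>U\<in>\<U>. K \<inter> U \<noteq> {})))"

definition proper_shore_point :: "'a topology \<Rightarrow> 'a \<Rightarrow> bool" where
  "proper_shore_point X p \<longleftrightarrow> p \<in> topspace X \<and>
     (\<forall>\<U>. finite \<U> \<and> (\<forall>U\<in>\<U>. openin X U \<and> U \<noteq> {}) \<longrightarrow>
        (\<exists>K. subcontinuum X K \<and> K \<subseteq> composant X p - {p} \<and> (\<forall>U\<in>\<U>. K \<inter> U \<noteq> {})))"

end

theory Submission
  imports Defs
begin

text \<open>If \<open>\<kappa>(p) = X\<close>, the two notions coincide, so suppose \<open>\<kappa>(p) \<noteq> X\<close>. Given open sets \<open>U\<^sub>1, \<dots>, U\<^sub>N\<close>, let \<open>C\<^sub>i\<close> be the component of \<open>p\<close> in \<open>X - U\<^sub>i\<close>. The sets \<open>{p}\<close> and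
  \<open>C\<^sub>i\<close> are closed subsets of \<open>\<kappa>(p)\<close>; as \<open>\<kappa>(p)\<close> is dense and not all of \<open>X\<close>, they cannot cover it.
  So some \<open>x \<noteq> p\<close> in \<open>\<kappa>(p)\<close> has the property that every subcontinuum through \<open>p\<close> and \<open>x\<close> meets
  every \<open>U\<^sub>i\<close>. Choose such a subcontinuum \<open>M\<close> irreducible between \<open>p\<close> and \<open>x\<close> inside a proper
  subcontinuum. The composant of \<open>x\<close> in \<open>M\<close> is dense in \<open>M\<close> and, by irreducibility, avoids \<open>p\<close>,
  so the union of finitely many proper subcontinua of \<open>M\<close> through \<open>x\<close> is as desired.\<close>

text \<open>By normality, the two halves of a separation of the intersection lie in disjoint open
  sets \<open>U\<close> and \<open>V\<close>. Compactness then puts some member of the chain inside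
  \<open>U \<union> V\<close>; that member meets both sets, against its connectedness.\<close>

lemma connectedin_Inter_chain:
  assumes "compact_space X" "Hausdorff_space X" "\<C> \<noteq> {}"
    and clo: "\<And>C. C \<in> \<C> \<Longrightarrow> closedin X C"
    and con: "\<And>C. C \<in> \<C> \<Longrightarrow> connectedin X C"
    and chain: "\<And>C D. C \<in> \<C> \<Longrightarrow> D \<in> \<C> \<Longrightarrow> C \<subseteq> D \<or> D \<subseteq> C"
  shows "connectedin X (\<Inter>\<C>)"
proof (rule ccontr)
  have I: "closedin X (\<Inter>\<C>)"
    using assms by blast
  assume "\<not> connectedin X (\<Inter>\<C>)"
  then obtain A B where "closedin X A" "closedin X B" "\<Inter>\<C> \<subseteq> A \<union> B"
    and AB: "A \<inter> B \<inter> \<Inter>\<C> = {}" "A \<inter> \<Inter>\<C> \<noteq> {}" "B \<inter> \<Inter>\<C> \<noteq> {}"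
    using closedin_subset [OF I] by (auto simp: connectedin_closedin)
  then have "closedin X (A \<inter> \<Inter>\<C>)" "closedin X (B \<inter> \<Inter>\<C>)" "disjnt (A \<inter> \<Inter>\<C>) (B \<inter> \<Inter>\<C>)"
    using I by (auto simp: disjnt_def)
  moreover have "normal_space X"
    using assms by (simp add: compact_Hausdorff_or_regular_imp_normal_space)
  ultimately obtain U V where UV: "openin X U" "openin X V" "A \<inter> \<Inter>\<C> \<subseteq> U" "B \<inter> \<Inter>\<C> \<subseteq> V" "disjnt U V"
    unfolding normal_space_def by metis
  have "\<exists>C\<in>\<C>. C \<subseteq> U \<union> V"
  proof (rule ccontr)
    assume no: "\<not> (\<exists>C\<in>\<C>. C \<subseteq> U \<union> V)"
    \<comment> \<open>What the members leave outside \<open>U \<union> V\<close>: a chain of closed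
      sets, all nonempty by \<open>no\<close>. A common point of them would lie in the intersection
      but outside its cover \<open>A \<union> B\<close>.\<close>
    let ?D = "(\<lambda>C. C - (U \<union> V)) ` \<C>"
    have "\<Inter>\<F> \<noteq> {}" if "finite \<F>" "\<F> \<subseteq> ?D" for \<F>
    proof (cases "\<F> = {}")
      case False
      have "subset.chain ?D \<F>"
        unfolding subset_chain_def
      proof (intro conjI ballI)
        fix S T
        assume "S \<in> \<F>" "T \<in> \<F>"
        then have "S \<in> ?D" "T \<in> ?D"
          using \<open>\<F> \<subseteq> ?D\<close> by (simp_all only: subsetD)
        then obtain C D where "C \<in> \<C>" "D \<in> \<C>" "S = C - (U \<union> V)" "T = D - (U \<union> V)"
          by (elim imageE) simp
        with chain [of C D] show "S \<subseteq> T \<or> T \<subseteq> S"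
          by blast
      qed (use that in auto)
      \<comment> \<open>A finite nonempty chain contains its own intersection as its least
        member.\<close>
      then have "\<Inter>\<F> \<in> ?D"
        using Inter_in_chain False that by blast
      then show ?thesis
        using no by auto
    qed auto
    moreover have "\<forall>S\<in>?D. closedin X S"
      using clo UV by (auto intro: closedin_diff)
    ultimately have "\<Inter>?D \<noteq> {}"
      using \<open>compact_space X\<close> [unfolded compact_space_fip, rule_format, of ?D] by simp
    then obtain y where "y \<in> \<Inter>?D"
      unfolding ex_in_conv [symmetric] by (elim exE)
    then have "\<And>C. C \<in> \<C> \<Longrightarrow> y \<in> C - (U \<union> V)"
      unfolding INT_iff by (rule bspec)
    then have "y \<in> \<Inter>\<C>" "y \<notin> U \<union> V"
      using \<open>\<C> \<noteq> {}\<close> by auto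
    then show False
      using \<open>\<Inter>\<C> \<subseteq> A \<union> B\<close> UV by blast
  qed
  then obtain C where "C \<in> \<C>" "C \<subseteq> U \<union> V"
    by blast
  moreover have "U \<inter> C \<noteq> {}" "V \<inter> C \<noteq> {}"
    using AB UV \<open>C \<in> \<C>\<close> by blast+
  moreover have "U \<inter> V \<inter> C = {}"
    using UV by (auto simp: disjnt_def)
  ultimately show False
    using connectedinD [OF con] UV by meson
qed

section \<open>Subcontinua: subspaces, unions and minimal elements\<close>

lemma subcontinuum_closedin:
  assumes "continuum X"
  shows "subcontinuum X K \<longleftrightarrow> K \<noteq> {} \<and> closedin X K \<and> connectedin X K"
  using assms unfolding continuum_def subcontinuum_def
  by (metis closedin_compact_space compactin_imp_closedin)

lemma subcontinuum_subtopology: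
  "subcontinuum (subtopology X M) K \<longleftrightarrow> subcontinuum X K \<and> K \<subseteq> M"
  by (auto simp: subcontinuum_def compactin_subtopology connectedin_subtopology)

lemma subcontinuum_subset_topspace: "subcontinuum X K \<Longrightarrow> K \<subseteq> topspace X"
  by (simp add: subcontinuum_def compactin_subset_topspace)

lemma continuum_subtopology:
  assumes "continuum X" "subcontinuum X M" "x \<in> M" "y \<in> M" "x \<noteq> y"
  shows "continuum (subtopology X M)"
proof -
  have "topspace (subtopology X M) = M"
    using assms subcontinuum_subset_topspace by (metis topspace_subtopology_subset)
  then show ?thesis
    using assms unfolding continuum_def subcontinuum_def
    by (metis Hausdorff_space_subtopology compact_space_subtopology connectedin_def)
qed

lemma subcontinuum_Union:
  assumes "finite \<K>" "\<K> \<noteq> {}" "\<And>K. K \<in> \<K> \<Longrightarrow> subcontinuum X K \<and> x \<in> K"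
  shows "subcontinuum X (\<Union>\<K>)"
proof -
  have "connectedin X (\<Union>\<K>)"
    using assms by (intro connectedin_Union) (auto simp: subcontinuum_def)
  moreover have "compactin X (\<Union>\<K>)"
    using assms by (intro compactin_Union) (auto simp: subcontinuum_def)
  ultimately show ?thesis
    using assms unfolding subcontinuum_def by blast
qed

text \<open>Zorn's lemma applied downwards: the intersection of a chain of subcontinua between
  \<open>S\<close> and \<open>K\<close> is again one, connected by
  \<open>connectedin_Inter_chain\<close> and nonempty because it contains \<open>S\<close>.\<close>

lemma irreducible_subcontinuum_exists:
  assumes X: "continuum X" and K: "subcontinuum X K" "S \<subseteq> K" "S \<noteq> {}"
  obtains M where "subcontinuum X M" "S \<subseteq> M" "M \<subseteq> K"
    "\<And>L. \<lbrakk>subcontinuum X L; S \<subseteq> L; L \<subseteq> M\<rbrakk> \<Longrightarrow> L = M"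
proof -
  \<comment> \<open>Complements are taken because \<open>subset_Zorn_nonempty\<close> yields maximal
    elements: a maximal \<open>T\<close> is the complement of a minimal subcontinuum.\<close>
  define \<A> where "\<A> = {T. T \<subseteq> topspace X \<and> subcontinuum X (topspace X - T) \<and>
    S \<subseteq> topspace X - T \<and> topspace X - T \<subseteq> K}"
  have inA: "topspace X - L \<in> \<A>" if "subcontinuum X L" "S \<subseteq> L" "L \<subseteq> K" for L
    using that subcontinuum_subset_topspace [OF that(1)] by (simp add: \<A>_def double_diff)
  have "\<exists>T\<in>\<A>. \<forall>Y\<in>\<A>. T \<subseteq> Y \<longrightarrow> Y = T"
  proof (rule subset_Zorn_nonempty)
    show "\<A> \<noteq> {}"
      using inA K by blast
    fix \<C>
    assume "\<C> \<noteq> {}" and ch: "subset.chain \<A> \<C>"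
    let ?D = "(\<lambda>T. topspace X - T) ` \<C>"
    have eq: "topspace X - \<Union>\<C> = \<Inter>?D"
      using \<open>\<C> \<noteq> {}\<close> by blast
    have D: "D \<noteq> {} \<and> closedin X D \<and> connectedin X D \<and> S \<subseteq> D \<and> D \<subseteq> K" if "D \<in> ?D" for D
      using that ch X by (auto simp: subset_chain_def \<A>_def subcontinuum_closedin)
    have "connectedin X (\<Inter>?D)"
    proof (rule connectedin_Inter_chain)
      show "C \<subseteq> D \<or> D \<subseteq> C" if "C \<in> ?D" "D \<in> ?D" for C D
        using that ch unfolding subset_chain_def by blast
    qed (use X D \<open>\<C> \<noteq> {}\<close> in \<open>auto simp: continuum_def\<close>)
    moreover have "closedin X (\<Inter>?D)"
      using D \<open>\<C> \<noteq> {}\<close> by blast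
    moreover have "S \<subseteq> \<Inter>?D" "\<Inter>?D \<subseteq> K"
      using D \<open>\<C> \<noteq> {}\<close> by blast+
    moreover have "\<Union>\<C> \<subseteq> topspace X"
      using ch by (auto simp: subset_chain_def \<A>_def)
    ultimately show "\<Union>\<C> \<in> \<A>"
      unfolding \<A>_def mem_Collect_eq eq subcontinuum_closedin [OF X] using \<open>S \<noteq> {}\<close> by blast
  qed
  then obtain T where T: "T \<in> \<A>" "\<And>Y. Y \<in> \<A> \<Longrightarrow> T \<subseteq> Y \<Longrightarrow> Y = T"
    by blast
  show thesis
  proof
    show "subcontinuum X (topspace X - T)" "S \<subseteq> topspace X - T" "topspace X - T \<subseteq> K"
      using T by (auto simp: \<A>_def)
    fix L
    assume L: "subcontinuum X L" "S \<subseteq> L" "L \<subseteq> topspace X - T"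
    then have "topspace X - L = T"
      using T inA [of L] by (intro T) (auto simp: \<A>_def)
    then show "L = topspace X - T"
      using L by blast
  qed
qed

section \<open>Components, boundary bumping and density of composants\<close>

lemma subcontinuum_connected_component_of:
  assumes X: "continuum X" and "openin X U" "p \<in> topspace X - U"
  shows "subcontinuum X (connected_component_of_set (subtopology X (topspace X - U)) p)"
    and "p \<in> connected_component_of_set (subtopology X (topspace X - U)) p"
proof -
  let ?C = "connected_component_of_set (subtopology X (topspace X - U)) p"
  show p: "p \<in> ?C"
    using assms by (simp add: connected_component_of_refl)
  have "closedin (subtopology X (topspace X - U)) ?C"
    by (rule closedin_connected_component_of)
  then have "closedin X ?C"
    using assms closedin_trans_full by blast
  moreover have "connectedin X ?C"
    using connectedin_connected_component_of connectedin_subtopology by metis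
  ultimately show "subcontinuum X ?C"
    using p X by (auto simp: subcontinuum_closedin)
qed

text \<open>By boundary bumping, the component of \<open>x\<close> in the complement of a smaller open set \<open>V\<close> with
  closure inside \<open>U\<close> reaches that closure.\<close>
lemma composant_meets_open:
  assumes X: "continuum X" and x: "x \<in> topspace X" and U: "openin X U" "U \<noteq> {}"
  obtains K where "subcontinuum X K" "K \<noteq> topspace X" "x \<in> K" "K \<inter> U \<noteq> {}"
proof (cases "x \<in> U")
  case True
  have "subcontinuum X {x}"
    using x by (auto simp: subcontinuum_def)
  moreover have "{x} \<noteq> topspace X"
    using X unfolding continuum_def by (metis singletonD)
  ultimately show thesis
    using True that by blast
next
  case False
  obtain y where y: "y \<in> U" "y \<in> topspace X"
    using U openin_subset by blast
  have "regular_space X"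
    using X by (simp add: continuum_def compact_Hausdorff_imp_regular_space)
  moreover have "closedin X (topspace X - U)" "y \<in> topspace X - (topspace X - U)"
    using U y by auto
  ultimately obtain V where V: "openin X V" "y \<in> V" "disjnt (topspace X - U) (X closure_of V)"
    unfolding regular_space by metis
  then have VU: "X closure_of V \<subseteq> U"
    using closure_of_subset_topspace by (fastforce simp: disjnt_def)
  then have "x \<notin> V"
    using False V closure_of_subset openin_subset by (metis subsetD)
  let ?C = "connected_component_of_set (subtopology X (topspace X - V)) x"
  have C: "subcontinuum X ?C" "x \<in> ?C"
    using subcontinuum_connected_component_of [OF X V(1)] x \<open>x \<notin> V\<close> by auto
  have "?C \<inter> X frontier_of (topspace X - V) \<noteq> {}"
  proof (rule boundary_bumping_theorem_closed)
    show "?C \<in> connected_components_of (subtopology X (topspace X - V))"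
      using x \<open>x \<notin> V\<close> by (simp add: connected_components_of_def)
  qed (use X V y in \<open>auto simp: continuum_def\<close>)
  \<comment> \<open>A set and its complement have the same frontier, so this one lies in the closure
    of \<open>V\<close>.\<close>
  moreover have "X frontier_of (topspace X - V) \<subseteq> U"
    using VU unfolding frontier_of_complement by (auto simp: frontier_of_def)
  ultimately have "?C \<inter> U \<noteq> {}"
    by (metis Int_mono order_refl subset_empty)
  moreover have "?C \<subseteq> topspace X - V"
    using connected_component_of_subset_topspace [of "subtopology X (topspace X - V)" x] by auto
  then have "?C \<noteq> topspace X"
    using V y by blast
  ultimately show thesis
    using C that by blast
qed

text \<open>Irreducibility forces a proper subcontinuum of \<open>M\<close> through \<open>x\<close>
  to miss \<open>p\<close>. By \<open>composant_meets_open\<close> in the subspace \<open>M\<close>,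
  such subcontinua reach every nonempty relatively open set, and finitely many of them unite at
  their common point \<open>x\<close>.\<close>

lemma irreducible_subcontinuum_avoids_endpoint:
  assumes X: "continuum X" and M: "subcontinuum X M" "p \<in> M" "x \<in> M" "p \<noteq> x"
    and irr: "\<And>L. \<lbrakk>subcontinuum X L; {p, x} \<subseteq> L; L \<subseteq> M\<rbrakk> \<Longrightarrow> L = M"
    and \<U>: "finite \<U>" "\<And>U. U \<in> \<U> \<Longrightarrow> openin X U \<and> M \<inter> U \<noteq> {}"
  obtains K where "subcontinuum X K" "K \<subseteq> M - {p}" "\<And>U. U \<in> \<U> \<Longrightarrow> K \<inter> U \<noteq> {}"
proof -
  let ?Y = "subtopology X M"
  have Y: "continuum ?Y" "topspace ?Y = M"
    using continuum_subtopology [OF X M] M subcontinuum_subset_topspace [OF M(1)] by auto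
  have "\<exists>L. subcontinuum X L \<and> x \<in> L \<and> L \<subseteq> M - {p} \<and> L \<inter> U \<noteq> {}" if U: "U \<in> \<U>" for U
  proof -
    have "openin ?Y (M \<inter> U)"
      using \<U> U openin_subtopology_Int2 by blast
    then obtain L where L: "subcontinuum ?Y L" "L \<noteq> M" "x \<in> L" "L \<inter> (M \<inter> U) \<noteq> {}"
      using composant_meets_open [OF Y(1), of x "M \<inter> U"] Y M \<U> U by metis
    then have "subcontinuum X L" "L \<subseteq> M"
      by (auto simp: subcontinuum_subtopology)
    moreover have "p \<notin> L"
      using irr [of L] L calculation by blast
    ultimately show ?thesis
      using L by blast
  qed
  then obtain f where f: "\<And>U. U \<in> \<U> \<Longrightarrow> subcontinuum X (f U) \<and> x \<in> f U \<and> f U \<subseteq> M - {p} \<and> f U \<inter> U \<noteq> {}"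
    by metis
  \<comment> \<open>The singleton keeps the union nonempty when \<open>\<U>\<close> is
    empty.\<close>
  let ?K = "\<Union>(insert {x} (f ` \<U>))"
  have "subcontinuum X {x}"
    using M subcontinuum_subset_topspace [OF M(1)] by (auto simp: subcontinuum_def)
  then have "subcontinuum X ?K"
    using \<U> f by (intro subcontinuum_Union [where x = x]) auto
  moreover have "?K \<subseteq> M - {p}"
  proof (rule Union_least)
    show "S \<subseteq> M - {p}" if "S \<in> insert {x} (f ` \<U>)" for S
      using that f M by (elim insertE imageE) simp_all
  qed
  moreover have "?K \<inter> U \<noteq> {}" if "U \<in> \<U>" for U
  proof -
    have "f U \<subseteq> ?K" "f U \<inter> U \<noteq> {}"
      using that f [OF that] by auto
    then show ?thesis
      by blast
  qed
  ultimately show thesis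
    using that by blast
qed

section \<open>Composants that are not the whole space\<close>

lemma composant_subset_topspace: "composant X p \<subseteq> topspace X"
  by (auto simp: composant_def dest: subcontinuum_subset_topspace)

text \<open>Otherwise each point of the composant other than \<open>p\<close> shares with
  \<open>p\<close> a subcontinuum missing some \<open>U\<close>, hence lies in the component of
  \<open>p\<close> outside that \<open>U\<close>. The composant is then a finite union of closed
  sets; being closed and dense, it would be all of \<open>X\<close>.\<close>

lemma composant_point_far_from_base:
  assumes X: "continuum X" and p: "p \<in> topspace X" and ne: "composant X p \<noteq> topspace X"
    and \<U>: "finite \<U>" "\<And>U. U \<in> \<U> \<Longrightarrow> openin X U \<and> U \<noteq> {}"
  shows "\<exists>x \<in> composant X p - {p}. \<forall>U\<in>\<U>. \<forall>K. subcontinuum X K \<and> p \<in> K \<and> x \<in> K \<longrightarrow> K \<inter> U \<noteq> {}"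
proof (rule ccontr)
  assume "\<not> ?thesis"
  then have contra: "\<exists>K U. subcontinuum X K \<and> p \<in> K \<and> x \<in> K \<and> U \<in> \<U> \<and> K \<inter> U = {}"
    if "x \<in> composant X p" "x \<noteq> p" for x
    using that by blast
  define C where "C U = connected_component_of_set (subtopology X (topspace X - U)) p" for U
  \<comment> \<open>A \<open>U\<close> containing \<open>p\<close> meets every subcontinuum through
    \<open>p\<close>, so only sets missing \<open>p\<close> can occur in
    \<open>contra\<close>.\<close>
  let ?V = "{U \<in> \<U>. p \<notin> U}"
  have C: "subcontinuum X (C U) \<and> p \<in> C U \<and> C U \<subseteq> topspace X - U" if "U \<in> ?V" for U
    using subcontinuum_connected_component_of [OF X, of U p] p \<U> that
      connected_component_of_subset_topspace [of "subtopology X (topspace X - U)" p]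
    by (auto simp: C_def)
  have "composant X p = \<Union>(insert {p} (C ` ?V))"
  proof (intro subset_antisym subsetI)
    fix x
    assume x: "x \<in> composant X p"
    show "x \<in> \<Union>(insert {p} (C ` ?V))"
    proof (cases "x = p")
      case False
      then obtain K U where K: "subcontinuum X K" "p \<in> K" "x \<in> K" "U \<in> \<U>" "K \<inter> U = {}"
        using contra x by metis
      then have "connectedin (subtopology X (topspace X - U)) K"
        using subcontinuum_subset_topspace [OF K(1)]
        by (auto simp: connectedin_subtopology subcontinuum_def)
      then have "K \<subseteq> C U"
        unfolding C_def using K connected_component_of_maximal by metis
      then show ?thesis
        using K by blast
    qed auto
  next
    fix x
    assume x: "x \<in> \<Union>(insert {p} (C ` ?V))"
    have "subcontinuum X {p}"
      using p by (auto simp: subcontinuum_def)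
    moreover have "{p} \<noteq> topspace X"
      using X unfolding continuum_def by (metis singletonD)
    moreover have "C U \<noteq> topspace X" if "U \<in> ?V" for U
    proof -
      have "U \<subseteq> topspace X" "U \<noteq> {}" "C U \<subseteq> topspace X - U"
        using C [OF that] \<U>(2) [of U] that by (simp_all add: openin_subset)
      then show ?thesis
        by blast
    qed
    \<comment> \<open>Each piece of the union is one of the subcontinua that make up the
      composant.\<close>
    ultimately have "subcontinuum X K \<and> K \<noteq> topspace X \<and> p \<in> K" if "K \<in> insert {p} (C ` ?V)" for K
      using that C by (elim insertE imageE) simp_all
    then have "K \<subseteq> composant X p" if "K \<in> insert {p} (C ` ?V)" for K
      unfolding composant_def by (intro Union_upper CollectI) (use that in blast)
    then show "x \<in> composant X p"
      using x by (meson UnionE subsetD)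
  qed
  moreover have "closedin X (\<Union>(insert {p} (C ` ?V)))"
  proof (rule closedin_Union)
    have "closedin X {p}"
      using X p by (simp add: continuum_def closedin_Hausdorff_singleton)
    moreover have "closedin X (C U)" if "U \<in> ?V" for U
      using C [OF that] X by (simp add: subcontinuum_closedin)
    ultimately show "closedin X S" if "S \<in> insert {p} (C ` ?V)" for S
      using that by auto
  qed (use \<U> in simp)
  ultimately have "closedin X (composant X p)"
    by simp
  moreover have "X closure_of (composant X p) = topspace X"
    unfolding dense_intersects_open
  proof (intro allI impI)
    fix T
    assume "openin X T \<and> T \<noteq> {}"
    then obtain K where "subcontinuum X K" "K \<noteq> topspace X" "p \<in> K" "K \<inter> T \<noteq> {}"
      using composant_meets_open [OF X p] by metis
    then show "composant X p \<inter> T \<noteq> {}"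
      unfolding composant_def by blast
  qed
  ultimately show False
    using ne by (simp add: closure_of_closedin)
qed

text \<open>The point \<open>x\<close> from \<open>composant_point_far_from_base\<close> makes every
  subcontinuum through \<open>p\<close> and \<open>x\<close> meet all of \<open>\<U>\<close>. For an
  irreducible one, \<open>irreducible_subcontinuum_avoids_endpoint\<close> then finds a part of it
  that misses \<open>p\<close> and still meets them all.\<close>

lemma composant_minus_point_approx:
  assumes X: "continuum X" and p: "p \<in> topspace X" and ne: "composant X p \<noteq> topspace X"
    and \<U>: "finite \<U>" "\<And>U. U \<in> \<U> \<Longrightarrow> openin X U \<and> U \<noteq> {}"
  obtains K where "subcontinuum X K" "K \<subseteq> composant X p - {p}" "\<And>U. U \<in> \<U> \<Longrightarrow> K \<inter> U \<noteq> {}"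
proof -
  obtain x where x: "x \<in> composant X p" "x \<noteq> p"
    "\<And>K U. \<lbrakk>subcontinuum X K; p \<in> K; x \<in> K; U \<in> \<U>\<rbrakk> \<Longrightarrow> K \<inter> U \<noteq> {}"
    using composant_point_far_from_base [OF X p ne \<U>] by auto
  obtain L where L: "subcontinuum X L" "L \<noteq> topspace X" "p \<in> L" "x \<in> L"
    using x by (auto simp: composant_def)
  \<comment> \<open>Minimizing inside the proper subcontinuum \<open>L\<close> keeps
    \<open>M\<close> within the composant of \<open>p\<close>.\<close>
  obtain M where M: "subcontinuum X M" "{p, x} \<subseteq> M" "M \<subseteq> L"
    "\<And>L. \<lbrakk>subcontinuum X L; {p, x} \<subseteq> L; L \<subseteq> M\<rbrakk> \<Longrightarrow> L = M"
    using irreducible_subcontinuum_exists [OF X L(1), of "{p, x}"] L by blast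
  have px: "p \<in> M" "x \<in> M" "p \<noteq> x"
    using M x by auto
  have MU: "openin X U \<and> M \<inter> U \<noteq> {}" if "U \<in> \<U>" for U
    using x(3) [OF M(1) px(1,2) that] \<U>(2) [OF that] by simp
  have "L \<subseteq> composant X p"
    using L by (auto simp: composant_def)
  then have sub: "M - {p} \<subseteq> composant X p - {p}"
    using M by blast
  show thesis
  proof (rule irreducible_subcontinuum_avoids_endpoint [OF X M(1) px M(4) \<U>(1) MU])
    fix K
    assume K: "subcontinuum X K" "K \<subseteq> M - {p}" "\<And>U. U \<in> \<U> \<Longrightarrow> K \<inter> U \<noteq> {}"
    show thesis
      by (rule that [OF K(1) subset_trans [OF K(2) sub] K(3)])
  qed
qed

theorem theorem2:
  fixes X :: "'a topology" and p :: 'a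
  assumes "continuum X" and "p \<in> topspace X"
  shows "shore_point X p \<longleftrightarrow> proper_shore_point X p"
proof
  assume "proper_shore_point X p"
  then show "shore_point X p"
    unfolding shore_point_def proper_shore_point_def
    using order_trans [OF _ Diff_mono [OF composant_subset_topspace [of X p] order_refl]] by metis
next
  assume shore: "shore_point X p"
  show "proper_shore_point X p"
  proof (cases "composant X p = topspace X")
    case True
    with shore show ?thesis
      by (simp add: shore_point_def proper_shore_point_def)
  next
    case False
    show ?thesis
      unfolding proper_shore_point_def
    proof (intro conjI allI impI)
      fix \<U>
      assume "finite \<U> \<and> (\<forall>U\<in>\<U>. openin X U \<and> U \<noteq> {})"
      then show "\<exists>K. subcontinuum X K \<and> K \<subseteq> composant X p - {p} \<and> (\<forall>U\<in>\<U>. K \<inter> U \<noteq> {})"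
        using composant_minus_point_approx [OF assms False, of \<U>] by metis
    qed (use assms in simp)
  qed
qed

end
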